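(* Let $R$ be a $p$-torsion free perfectoid ring containing a compatible system $(p^{1/p^e})_{e\ge0}$ of $p$-power roots of $p$, and let $n\ge1$. Put $i_m=\frac1p+\cdots+\frac1{p^m}$ for $m\ge1$ and $i_0=0$. Then there exist an $\overline R$-linear map $\overline\psi_n:Q_{R,n}\to R/p^{i_n}R$ and a unit $w\in R/pR$ such that $\overline\psi_n(1)=1$ and $\overline\psi_n(V^{n-1}[a])=w\,p^{i_{n-1}}F^{-n}(a)$ for every $a\in R$.
   Context: For $\alpha=k/p^e\in\mathbb{Z}[1/p]_{\ge 0}$, $p^\alpha:=(p^{1/p^e})^k$. $\overline R=R/pR$. $W_n$: $p$-typical Witt vectors of length $n$, $[\cdot]$ Teichmüller, $V$ Verschiebung. $\Phi_{R,n}:\overline R\to W_n(R)/pW_n(R)$, $a\mapsto[\tilde a^p]$ ($\tilde a$ a lift) is a well-defined ring map, and $Q_{R,n}$ is $W_n(R)/pW_n(R)$ viewed as an $\overline R$-module via $\Phi_{R,n}$. Here $V^{n-1}[a]$ denotes the class in $Q_{R,n}$ of $V^{n-1}([a])$. For a perfectoid $R$ the $p^n$-th power map induces an isomorphism $R/p^{1/p^n}R\xrightarrow{\sim}R/pR$; $F^{-n}(a)\in R/p^{1/p^n}R$ denotes the preimage of the class of $a$, and $p^{i_{n-1}}F^{-n}(a)$ is regarded as an element of $R/p^{i_n}R$ (well defined since $i_{n-1}+p^{-n}=i_n$). *)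

theory Defs
  imports Main "HOL-Computational_Algebra.Primes"
begin

text \<open>The ring R is the whole type 'a (a commutative ring). The ideal cR is
  expressed via divisibility: x \<in> cR iff c dvd x.\<close>

definition p_torsion_free :: "nat \<Rightarrow> 'a::comm_ring_1 itself \<Rightarrow> bool" where
  "p_torsion_free p _ \<longleftrightarrow> (\<forall>x::'a. of_nat p * x = 0 \<longrightarrow> x = 0)"

definition p_adically_complete :: "nat \<Rightarrow> 'a::comm_ring_1 itself \<Rightarrow> bool" where
  "p_adically_complete p _ \<longleftrightarrow>
     (\<forall>x::'a. (\<forall>k. of_nat p ^ k dvd x) \<longrightarrow> x = 0) \<and>
     (\<forall>f::nat \<Rightarrow> 'a. (\<forall>k. of_nat p ^ k dvd (f (Suc k) - f k)) \<longrightarrow>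
        (\<exists>x. \<forall>k. of_nat p ^ k dvd (x - f k)))"

definition compatible_roots :: "nat \<Rightarrow> (nat \<Rightarrow> 'a::comm_ring_1) \<Rightarrow> bool" where
  "compatible_roots p rt \<longleftrightarrow> rt 0 = of_nat p \<and> (\<forall>e. rt (Suc e) ^ p = rt e)"

text \<open>Perfectoid (for a p-torsion free ring containing p^(1/p), BMS Lemma 3.10):
  R is p-adically complete and Frobenius induces an isomorphism
  R/p^(1/p)R \<rightarrow> R/pR.\<close>
definition perfectoid :: "nat \<Rightarrow> (nat \<Rightarrow> 'a::comm_ring_1) \<Rightarrow> bool" where
  "perfectoid p rt \<longleftrightarrow> p_adically_complete p TYPE('a) \<and>
     (\<forall>x::'a. \<exists>y. of_nat p dvd (y ^ p - x)) \<and>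
     (\<forall>y::'a. of_nat p dvd y ^ p \<longrightarrow> rt 1 dvd y)"

text \<open>p^(i_m) with i_m = 1/p + ... + 1/p^m, i.e. (p^(1/p^m))^(p^(m-1)+...+1).\<close>
definition p_i :: "nat \<Rightarrow> (nat \<Rightarrow> 'a::comm_ring_1) \<Rightarrow> nat \<Rightarrow> 'a" where
  "p_i p rt m = rt m ^ (\<Sum>j\<in>{1..m}. p ^ (m - j))"

text \<open>Witt vectors of length n over a p-torsion free ring, realised through the
  (injective) ghost map as a subring of R^n with componentwise operations.
  Elements are functions nat \<Rightarrow> 'a, zero from index n on.\<close>
definition ghost :: "nat \<Rightarrow> nat \<Rightarrow> (nat \<Rightarrow> 'a::comm_ring_1) \<Rightarrow> nat \<Rightarrow> 'a" where
  "ghost p n a k = (if k < n then (\<Sum>i\<le>k. of_nat p ^ i * a i ^ (p ^ (k - i))) else 0)"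

definition witt :: "nat \<Rightarrow> nat \<Rightarrow> (nat \<Rightarrow> 'a::comm_ring_1) set" where
  "witt p n = range (ghost p n)"

definition w_add :: "(nat \<Rightarrow> 'a::comm_ring_1) \<Rightarrow> (nat \<Rightarrow> 'a) \<Rightarrow> nat \<Rightarrow> 'a" where
  "w_add x y = (\<lambda>k. x k + y k)"

definition w_mult :: "(nat \<Rightarrow> 'a::comm_ring_1) \<Rightarrow> (nat \<Rightarrow> 'a) \<Rightarrow> nat \<Rightarrow> 'a" where
  "w_mult x y = (\<lambda>k. x k * y k)"

definition w_p_times :: "nat \<Rightarrow> (nat \<Rightarrow> 'a::comm_ring_1) \<Rightarrow> nat \<Rightarrow> 'a" where
  "w_p_times p x = (\<lambda>k. of_nat p * x k)"

definition teich :: "nat \<Rightarrow> nat \<Rightarrow> 'a::comm_ring_1 \<Rightarrow> nat \<Rightarrow> 'a" where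
  "teich p n a = ghost p n (\<lambda>i. if i = 0 then a else 0)"

definition w_one :: "nat \<Rightarrow> nat \<Rightarrow> nat \<Rightarrow> 'a::comm_ring_1" where
  "w_one p n = teich p n 1"

definition verV :: "nat \<Rightarrow> nat \<Rightarrow> 'a::comm_ring_1 \<Rightarrow> nat \<Rightarrow> 'a" where
  "verV p n a = ghost p n (\<lambda>i. if i = n - 1 then a else 0)"

text \<open>A function psi on representatives W_n(R) \<rightarrow> R induces an R/pR-linear map
  Q_{R,n} = W_n(R)/pW_n(R) \<rightarrow> R/cR (R/pR acting on Q via a \<mapsto> [a^p]).\<close>
definition induces_Qlinear ::
  "nat \<Rightarrow> nat \<Rightarrow> 'a::comm_ring_1 \<Rightarrow> ((nat \<Rightarrow> 'a) \<Rightarrow> 'a) \<Rightarrow> bool" where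
  "induces_Qlinear p n c psi \<longleftrightarrow>
     (\<forall>x\<in>witt p n. \<forall>y\<in>witt p n. (\<exists>z\<in>witt p n. (\<lambda>k. x k - y k) = w_p_times p z)
         \<longrightarrow> c dvd (psi x - psi y)) \<and>
     (\<forall>x\<in>witt p n. \<forall>y\<in>witt p n. c dvd (psi (w_add x y) - psi x - psi y)) \<and>
     (\<forall>a. \<forall>x\<in>witt p n. c dvd (psi (w_mult (teich p n (a ^ p)) x) - a * psi x))"

end

theory Submission
  imports Defs "HOL-Library.Function_Algebras"
begin

text \<open>Write \<open>\<Phi>(a)\<close> for the class of \<open>[a ^ p]\<close> in \<open>Q = W\<^sub>n(R) / p W\<^sub>n(R)\<close>. The map \<open>\<Phi>\<close> is additive,
  surjective, and has kernel \<open>p\<^bsup>i_n\<^esup> R\<close>, so the required map is its inverse. The kernel and the surjectivity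
  both come from the Witt components \<open>z\<^sub>k\<close> of \<open>[x] / p\<close>: solving the ghost equations
  \<open>x ^ (p ^ k) = p (z\<^sub>0 ^ (p ^ k) + \<dots> + p ^ k z\<^sub>k)\<close> gives \<open>p ^ (1 + p + \<dots> + p ^ k) z\<^sub>k = u\<^sub>k x ^ (p ^ k)\<close> with
  universal integers \<open>u\<^sub>k\<close> prime to \<open>p\<close>. Hence \<open>[x]\<close> is divisible by \<open>p\<close> in \<open>W\<^sub>n(R)\<close> iff
  \<open>p ^ (1 + 1/p + \<dots> + 1/p ^ (n-1))\<close> divides \<open>x\<close>, and for \<open>x = p ^ (1 + 1/p + \<dots> + 1/p ^ (m-1))\<close> the first obstruction
  is \<open>[x] \<equiv> u\<^sub>m V ^ m (1)\<close> modulo \<open>p\<close> and \<open>V ^ (m+1)\<close>. The case \<open>m = n - 1\<close> computes \<open>\<psi>(V ^ (n-1) [a])\<close>, with \<open>w\<close>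
  an inverse of \<open>u\<^sub>n\<^sub>-\<^sub>1\<close> modulo \<open>p\<close>.\<close>

subsection \<open>Congruences in non-unital subrings\<close>

lemma power_fun_apply: "(f ^ n) x = f x ^ n" for f :: "'b \<Rightarrow> 'a::comm_ring_1"
  by (induction n) auto

lemma sum_fun_apply: "sum f A x = (\<Sum>i\<in>A. f i x)" for f :: "'c \<Rightarrow> 'b \<Rightarrow> 'a::comm_ring_1"
  by (induction A rule: infinite_finite_induct) auto

text \<open>No unit is demanded: \<open>witt p n\<close> is studied inside the ring of all
  functions, whose constant \<open>1\<close> does not vanish from index \<open>n\<close> on.\<close>

locale subrng =
  fixes S :: "'b::comm_ring_1 set"
  assumes zero_mem: "0 \<in> S"
    and diff_mem: "x \<in> S \<Longrightarrow> y \<in> S \<Longrightarrow> x - y \<in> S"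
    and mult_mem: "x \<in> S \<Longrightarrow> y \<in> S \<Longrightarrow> x * y \<in> S"
begin

lemma uminus_mem: "x \<in> S \<Longrightarrow> - x \<in> S"
  using diff_mem[OF zero_mem, of x] by simp

lemma add_mem: "x \<in> S \<Longrightarrow> y \<in> S \<Longrightarrow> x + y \<in> S"
  using diff_mem[of x "- y"] uminus_mem by simp

lemma of_nat_mult_mem: "x \<in> S \<Longrightarrow> of_nat k * x \<in> S"
  by (induction k) (auto simp: algebra_simps zero_mem add_mem)

lemma of_nat_power_mult_mem: "x \<in> S \<Longrightarrow> of_nat q ^ k * x \<in> S"
  using of_nat_mult_mem[of x "q ^ k"] by simp

lemma power_mem: "x \<in> S \<Longrightarrow> k > 0 \<Longrightarrow> x ^ k \<in> S"
  by (induction k) (auto simp: mult_mem elim: Suc_lessE, metis mult.right_neutral mult_mem neq0_conv power_0)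

lemma sum_mem: "(\<And>i. i \<in> A \<Longrightarrow> f i \<in> S) \<Longrightarrow> sum f A \<in> S"
  by (induction A rule: infinite_finite_induct) (auto simp: zero_mem add_mem)

end

text \<open>The quotient has to lie in \<open>S\<close>, not just in the ambient ring. For elements
  of \<open>S = witt p n\<close> and \<open>c = of_nat p\<close> this is equality in
  Q_{R,n}.\<close>

definition scong :: "'b::comm_ring_1 set \<Rightarrow> 'b \<Rightarrow> 'b \<Rightarrow> 'b \<Rightarrow> bool" where
  "scong S c x y \<longleftrightarrow> (\<exists>z\<in>S. x - y = c * z)"

context subrng
begin

lemma scong_refl: "scong S c x x"
  unfolding scong_def by (rule bexI[OF _ zero_mem]) simp

lemma scong_sym: "scong S c x y \<Longrightarrow> scong S c y x"
  unfolding scong_def by (metis minus_diff_eq mult_minus_right uminus_mem)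

lemma scong_trans [trans]: "scong S c x y \<Longrightarrow> scong S c y z \<Longrightarrow> scong S c x z"
proof -
  assume "scong S c x y" "scong S c y z"
  then obtain u v where "u \<in> S" "v \<in> S" "x - y = c * u" "y - z = c * v"
    unfolding scong_def by blast
  then have "x - z = c * (u + v)"
    by (metis diff_add_cancel add_diff_eq distrib_left)
  then show ?thesis
    unfolding scong_def using add_mem[OF \<open>u \<in> S\<close> \<open>v \<in> S\<close>] by blast
qed

lemma scong_add:
  assumes "scong S c x y" "scong S c x' y'"
  shows "scong S c (x + x') (y + y')"
proof -
  obtain u v where "u \<in> S" "v \<in> S" "x - y = c * u" "x' - y' = c * v"
    using assms unfolding scong_def by blast
  then have "(x + x') - (y + y') = c * (u + v)"
    unfolding distrib_left by (metis add_diff_eq diff_add_eq diff_diff_eq)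
  then show ?thesis
    unfolding scong_def using add_mem[OF \<open>u \<in> S\<close> \<open>v \<in> S\<close>] by blast
qed

lemma scong_uminus:
  assumes "scong S c x y"
  shows "scong S c (- x) (- y)"
proof -
  obtain z where "z \<in> S" "x - y = c * z"
    using assms unfolding scong_def by blast
  then show ?thesis
    unfolding scong_def using uminus_mem by (intro bexI[of _ "- z"]) (auto simp: algebra_simps)
qed

lemma scong_diff: "scong S c x y \<Longrightarrow> scong S c x' y' \<Longrightarrow> scong S c (x - x') (y - y')"
  using scong_add[of c x y "- x'" "- y'"] scong_uminus by simp

lemma scong_mult_left: "s \<in> S \<Longrightarrow> scong S c x y \<Longrightarrow> scong S c (s * x) (s * y)"
  unfolding scong_def by (metis mult.left_commute mult_mem right_diff_distrib)

lemma scong_mult: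
  assumes "scong S c x x'" "scong S c y y'" "x' \<in> S" "y \<in> S"
  shows "scong S c (x * y) (x' * y')"
proof -
  have "scong S c (y * x) (y * x')" "scong S c (x' * y) (x' * y')"
    using assms scong_mult_left by blast+
  then show ?thesis
    using scong_trans by (metis mult.commute)
qed

lemma scong_sum:
  "(\<And>i. i \<in> A \<Longrightarrow> scong S c (f i) (g i)) \<Longrightarrow> scong S c (sum f A) (sum g A)"
  by (induction A rule: infinite_finite_induct) (auto simp: scong_refl scong_add)

end

text \<open>Each middle binomial term has a coefficient divisible by \<open>p\<close> and a positive
  power of \<open>y\<close>. Asking only that \<open>x\<close> stabilise \<open>J\<close> allows
  \<open>J\<close> to be a scaled copy of a subring, so that divisibility of \<open>y\<close>
  carries over to the error.\<close>

lemma prime_power_sum: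
  assumes "prime p" "subrng J" "y \<in> J" and ideal: "\<And>t. t \<in> J \<Longrightarrow> x * t \<in> J"
  shows "\<exists>z\<in>J. (x + y) ^ p = x ^ p + y ^ p + of_nat p * z"
proof -
  interpret subrng J by fact
  have p2: "p \<ge> 2" using prime_ge_2_nat[OF assms(1)] .
  have xt: "x ^ k * t \<in> J" if "t \<in> J" for k t
    using that by (induction k) (auto simp: ideal mult.assoc)
  define z where "z = (\<Sum>k\<in>{1..<p}. of_nat ((p choose k) div p) * (x ^ k * y ^ (p - k)))"
  have "z \<in> J"
    unfolding z_def by (intro sum_mem of_nat_mult_mem xt power_mem assms) auto
  have *: "of_nat p * (of_nat ((p choose k) div p) * (x ^ k * y ^ (p - k)))
            = of_nat (p choose k) * x ^ k * y ^ (p - k)" if "k \<in> {1..<p}" for k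
  proof -
    have "p dvd (p choose k)"
      using that assms(1) by (intro dvd_choose_prime) auto
    then have "of_nat (p choose k) = (of_nat p * of_nat ((p choose k) div p) :: 'a)"
      by (metis dvd_mult_div_cancel of_nat_mult)
    then show ?thesis by (simp add: mult.assoc)
  qed
  have "(x + y) ^ p = (\<Sum>k\<le>p. of_nat (p choose k) * x ^ k * y ^ (p - k))"
    by (rule binomial_ring)
  also have "{..p} = insert 0 (insert p {1..<p})"
    using p2 by auto
  also have "(\<Sum>k\<in>\<dots>. of_nat (p choose k) * x ^ k * y ^ (p - k)) =
      y ^ p + (x ^ p + (\<Sum>k\<in>{1..<p}. of_nat (p choose k) * x ^ k * y ^ (p - k)))"
    using p2 by simp
  also have "(\<Sum>k\<in>{1..<p}. of_nat (p choose k) * x ^ k * y ^ (p - k)) = of_nat p * z"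
    unfolding z_def sum_distrib_left by (rule sum.cong) (simp_all only: *)
  finally show ?thesis
    using \<open>z \<in> J\<close> by (auto simp: algebra_simps)
qed

lemma (in subrng) subrng_scale: "subrng ((\<lambda>z. of_nat q ^ k * z) ` S)"
proof
  show "0 \<in> (\<lambda>z. of_nat q ^ k * z) ` S"
    using zero_mem by (intro image_eqI[of _ _ 0]) auto
next
  fix x y assume "x \<in> (\<lambda>z. of_nat q ^ k * z) ` S" "y \<in> (\<lambda>z. of_nat q ^ k * z) ` S"
  then obtain u v where uv: "u \<in> S" "v \<in> S" "x = of_nat q ^ k * u" "y = of_nat q ^ k * v"
    by auto
  show "x - y \<in> (\<lambda>z. of_nat q ^ k * z) ` S"
    using uv diff_mem by (intro image_eqI[of _ _ "u - v"]) (auto simp: right_diff_distrib)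
  show "x * y \<in> (\<lambda>z. of_nat q ^ k * z) ` S"
    using uv mult_mem of_nat_power_mult_mem
    by (intro image_eqI[of _ _ "of_nat q ^ k * u * v"]) (auto simp: ac_simps)
qed

lemma (in subrng) scong_prime_power:
  assumes "prime p" "scong S (of_nat p ^ k) x y" "y \<in> S" "k > 0"
  shows "scong S (of_nat p ^ Suc k) (x ^ p) (y ^ p)"
proof -
  obtain z where z: "z \<in> S" "x = y + of_nat p ^ k * z"
    using assms(2) unfolding scong_def by (metis add.commute diff_add_cancel)
  have p2: "p \<ge> 2" using prime_ge_2_nat[OF assms(1)] .
  \<comment> \<open>With the multiples of \<open>p ^ k\<close> as \<open>J\<close>, the middle
    binomial terms add up to a multiple of \<open>p ^ (k + 1)\<close>.\<close>
  have "\<exists>t\<in>(\<lambda>z. of_nat p ^ k * z) ` S.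
      (y + of_nat p ^ k * z) ^ p = y ^ p + (of_nat p ^ k * z) ^ p + of_nat p * t"
  proof (rule prime_power_sum[OF assms(1) subrng_scale])
    fix t assume "t \<in> (\<lambda>z. of_nat p ^ k * z) ` S"
    then obtain s where "s \<in> S" "t = of_nat p ^ k * s" by auto
    then show "y * t \<in> (\<lambda>z. of_nat p ^ k * z) ` S"
      using assms(3) mult_mem by (intro image_eqI[of _ _ "y * s"]) (auto simp: ac_simps)
  qed (use z in auto)
  then obtain t where t: "t \<in> S"
    "x ^ p = y ^ p + (of_nat p ^ k * z) ^ p + of_nat p * (of_nat p ^ k * t)"
    using z by auto
  \<comment> \<open>The remaining term carries \<open>p ^ (k * p)\<close>, and \<open>k * p\<close>
    is at least \<open>k + 1\<close>.\<close>
  have "Suc k \<le> k * 2" using assms(4) by simp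
  also have "\<dots> \<le> k * p" using p2 by (rule mult_le_mono2)
  finally have "k * p = Suc k + (k * p - Suc k)" by simp
  then have "(of_nat p ^ k * z) ^ p = of_nat p ^ Suc k * (of_nat p ^ (k * p - Suc k) * z ^ p)"
    by (metis (no_types) mult.assoc power_add power_mult power_mult_distrib)
  then have "x ^ p - y ^ p = of_nat p ^ Suc k * (of_nat p ^ (k * p - Suc k) * z ^ p + t)"
    using t(2) by (simp add: algebra_simps)
  moreover have "of_nat p ^ (k * p - Suc k) * z ^ p + t \<in> S"
    using t(1) z p2 by (intro add_mem of_nat_power_mult_mem power_mem) auto
  ultimately show ?thesis
    unfolding scong_def by blast
qed

lemma (in subrng) scong_prime_power_iterate:
  assumes "prime p" "scong S (of_nat p) x y" "x \<in> S" "y \<in> S"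
  shows "scong S (of_nat p ^ Suc j) (x ^ (p ^ j)) (y ^ (p ^ j))"
proof (induction j)
  case (Suc j)
  then show ?case
    using scong_prime_power[OF assms(1) Suc] assms prime_gt_0_nat[OF assms(1)]
    by (simp add: power_mem flip: power_mult power_Suc2)
qed (use assms in auto)

lemma (in subrng) scong_scale:
  "scong S c x y \<Longrightarrow> scong S (d * c) (d * x) (d * y)"
  unfolding scong_def by (metis mult.assoc right_diff_distrib)

subsection \<open>The ring structure on Witt vectors\<close>

definition witt_poly :: "nat \<Rightarrow> (nat \<Rightarrow> 'b::comm_ring_1) \<Rightarrow> nat \<Rightarrow> 'b" where
  "witt_poly p c k = (\<Sum>i\<le>k. of_nat p ^ i * c i ^ (p ^ (k - i)))"

lemma ghost_eq_witt_poly: "ghost p n c k = (if k < n then witt_poly p c k else 0)"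
  by (simp add: ghost_def witt_poly_def)

lemma witt_poly_cong: "(\<And>i. i \<le> k \<Longrightarrow> c i = d i) \<Longrightarrow> witt_poly p c k = witt_poly p d k"
  by (simp add: witt_poly_def)

lemma witt_poly_apply: "witt_poly p C k j = witt_poly p (\<lambda>i. C i j) k"
  for C :: "nat \<Rightarrow> 'c \<Rightarrow> 'b::comm_ring_1"
proof -
  have "(of_nat p ^ i) j = (of_nat p ^ i :: 'b)" for i
    by (simp add: power_fun_apply)
  then show ?thesis
    by (simp add: witt_poly_def sum_fun_apply power_fun_apply)
qed

text \<open>\<open>R\<close> itself need not have a Frobenius lift. Evaluation at \<open>0\<close> maps the following ring of sequences onto \<open>R\<close>, and on
  it the left shift is a Frobenius lift, so Dwork's criterion describes its Witt vectors and shows that they form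
  a ring; this descends to \<open>witt p n\<close>.\<close>

inductive_set teich_ring :: "nat \<Rightarrow> (nat \<Rightarrow> 'a::comm_ring_1) set" for p where
  gen: "(\<lambda>j. a ^ (p ^ j)) \<in> teich_ring p"
| diff: "x \<in> teich_ring p \<Longrightarrow> y \<in> teich_ring p \<Longrightarrow> x - y \<in> teich_ring p"
| mult: "x \<in> teich_ring p \<Longrightarrow> y \<in> teich_ring p \<Longrightarrow> x * y \<in> teich_ring p"

lemma subrng_teich_ring: "subrng (teich_ring p)"
proof
  show "0 \<in> teich_ring p"
    using teich_ring.diff[OF teich_ring.gen[of 1] teich_ring.gen[of 1], of p] by simp
qed (auto intro: teich_ring.intros)

interpretation teich_ring: subrng "teich_ring p" for p
  by (rule subrng_teich_ring)

definition shift :: "(nat \<Rightarrow> 'a) \<Rightarrow> nat \<Rightarrow> 'a" where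
  "shift x = (\<lambda>j. x (Suc j))"

lemma shift_diff: "shift (x - y) = shift x - shift y" for x y :: "nat \<Rightarrow> 'a::comm_ring_1"
  by (auto simp: shift_def)

lemma shift_mult: "shift (x * y) = shift x * shift y" for x y :: "nat \<Rightarrow> 'a::comm_ring_1"
  by (auto simp: shift_def)

lemma shift_witt_poly: "shift (witt_poly p c k) = witt_poly p (\<lambda>i. shift (c i)) k"
  by (rule ext) (simp add: shift_def witt_poly_apply)

lemma shift_mem_teich_ring: "x \<in> teich_ring p \<Longrightarrow> shift x \<in> teich_ring p"
proof (induction rule: teich_ring.induct)
  case (gen a)
  have "shift (\<lambda>j. a ^ (p ^ j)) = (\<lambda>j. (a ^ p) ^ (p ^ j))"
    by (simp add: shift_def flip: power_mult)
  then show ?case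
    using teich_ring.gen[of "a ^ p" p] by simp
next
  case (diff x y)
  then show ?case unfolding shift_diff by (intro teich_ring.diff)
next
  case (mult x y)
  then show ?case unfolding shift_mult by (intro teich_ring.mult)
qed

text \<open>On generators the two sides agree exactly, and the congruence passes to differences and
  products. So \<open>shift\<close> is a Frobenius lift on \<open>teich_ring p\<close>.\<close>

lemma shift_scong_power:
  assumes "prime p" "x \<in> teich_ring p"
  shows "scong (teich_ring p) (of_nat p) (shift x) (x ^ p)"
  using assms(2)
proof (induction rule: teich_ring.induct)
  case (gen a)
  have "shift (\<lambda>j. a ^ (p ^ j)) = (\<lambda>j. a ^ (p ^ j)) ^ p"
    by (auto simp: shift_def power_fun_apply mult.commute simp flip: power_mult)
  then show ?case
    by (simp add: teich_ring.scong_refl)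
next
  case (diff x y)
  \<comment> \<open>Expanding \<open>x = (x - y) + y\<close> gives the p-th power of the difference
    modulo \<open>p\<close>, also for \<open>p = 2\<close>, without a sign discussion.\<close>
  have "\<exists>z\<in>teich_ring p. ((x - y) + y) ^ p = (x - y) ^ p + y ^ p + of_nat p * z"
    using diff by (intro prime_power_sum assms subrng_teich_ring) (auto intro: teich_ring.intros)
  then have "scong (teich_ring p) (of_nat p) (x ^ p - y ^ p) ((x - y) ^ p)"
    unfolding scong_def by (auto simp: algebra_simps)
  then show ?case
    unfolding shift_diff using diff teich_ring.scong_diff teich_ring.scong_trans by blast
next
  case (mult x y)
  then show ?case
    unfolding shift_mult power_mult_distrib using prime_gt_0_nat[OF assms(1)]
    by (intro teich_ring.scong_mult) (auto intro: teich_ring.power_mem shift_mem_teich_ring)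
qed

text \<open>Termwise: \<open>shift (c i)\<close> and \<open>c i ^ p\<close> agree modulo
  \<open>p\<close>, hence their powers with exponent \<open>p ^ (k - i)\<close> agree modulo
  \<open>p ^ (k - i + 1)\<close>, and the factor \<open>p ^ i\<close> supplies the rest.\<close>

lemma shift_witt_poly_scong:
  fixes c :: "nat \<Rightarrow> nat \<Rightarrow> 'a::comm_ring_1"
  assumes "prime p" "\<And>i. i \<le> k \<Longrightarrow> c i \<in> teich_ring p"
  shows "scong (teich_ring p) (of_nat p ^ Suc k) (shift (witt_poly p c k))
           (\<Sum>i\<le>k. of_nat p ^ i * c i ^ (p ^ (Suc k - i)))"
  unfolding shift_witt_poly unfolding witt_poly_def
proof (rule teich_ring.scong_sum)
  fix i assume i: "i \<in> {..k}"
  have "scong (teich_ring p) (of_nat p ^ Suc (k - i)) (shift (c i) ^ (p ^ (k - i))) ((c i ^ p) ^ (p ^ (k - i)))"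
    using assms i prime_gt_0_nat[OF assms(1)]
    by (intro teich_ring.scong_prime_power_iterate shift_scong_power) (auto intro: teich_ring.power_mem shift_mem_teich_ring)
  then have "scong (teich_ring p) (of_nat p ^ i * of_nat p ^ Suc (k - i))
      (of_nat p ^ i * shift (c i) ^ (p ^ (k - i))) (of_nat p ^ i * (c i ^ p) ^ (p ^ (k - i)))"
    by (rule teich_ring.scong_scale)
  moreover have *: "of_nat p ^ i * of_nat p ^ Suc (k - i) = (of_nat p ^ Suc k :: nat \<Rightarrow> 'a)"
    using i by (simp flip: power_add del: power_Suc)
  ultimately show "scong (teich_ring p) (of_nat p ^ Suc k)
      (of_nat p ^ i * shift (c i) ^ (p ^ (k - i))) (of_nat p ^ i * c i ^ (p ^ (Suc k - i)))"
    using * i by (simp add: Suc_diff_le flip: power_mult)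
qed

lemma witt_poly_Suc:
  "witt_poly p c (Suc k) = (\<Sum>i\<le>k. of_nat p ^ i * c i ^ (p ^ (Suc k - i))) + of_nat p ^ Suc k * c (Suc k)"
  by (simp add: witt_poly_def)

lemma witt_poly_mem_teich_ring:
  assumes "prime p" "\<And>i. i \<le> k \<Longrightarrow> c i \<in> teich_ring p"
  shows "witt_poly p c k \<in> teich_ring p"
  unfolding witt_poly_def using assms prime_gt_0_nat[OF assms(1)]
  by (intro teich_ring.sum_mem teich_ring.of_nat_power_mult_mem teich_ring.power_mem) auto

text \<open>The sum over \<open>i \<le> k\<close> in \<open>witt_poly_Suc\<close> is the shifted
  k-th coordinate modulo \<open>p ^ (k + 1)\<close>. Conversely, the quotient in the congruence is
  the next Witt component, so components are found one at a time.\<close>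

lemma dwork:
  assumes "prime p"
  shows "(\<exists>c. (\<forall>i<n. c i \<in> teich_ring p) \<and> (\<forall>k<n. X k = witt_poly p c k)) \<longleftrightarrow>
    (\<forall>k<n. X k \<in> teich_ring p) \<and>
    (\<forall>k. Suc k < n \<longrightarrow> scong (teich_ring p) (of_nat p ^ Suc k) (shift (X k)) (X (Suc k)))"
    (is "?L \<longleftrightarrow> ?R")
proof
  assume ?L
  then obtain c where c: "\<And>i. i < n \<Longrightarrow> c i \<in> teich_ring p" "\<And>k. k < n \<Longrightarrow> X k = witt_poly p c k"
    by blast
  have "scong (teich_ring p) (of_nat p ^ Suc k) (shift (X k)) (X (Suc k))" if "Suc k < n" for k
  proof -
    have "scong (teich_ring p) (of_nat p ^ Suc k) (shift (X k)) (\<Sum>i\<le>k. of_nat p ^ i * c i ^ (p ^ (Suc k - i)))"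
      using shift_witt_poly_scong[OF assms, of k c] c that by simp
    also have "scong (teich_ring p) (of_nat p ^ Suc k) \<dots> (X (Suc k))"
      unfolding c(2)[OF that] witt_poly_Suc scong_def
      using c(1)[OF that] by (intro bexI[of _ "- c (Suc k)"] teich_ring.uminus_mem) auto
    finally show ?thesis .
  qed
  then show ?R
    using c by (auto intro!: witt_poly_mem_teich_ring[OF assms])
next
  assume R: ?R
  then show ?L
  proof (induction n)
    case (Suc n)
    then obtain c where c: "\<And>i. i < n \<Longrightarrow> c i \<in> teich_ring p" "\<And>k. k < n \<Longrightarrow> X k = witt_poly p c k"
      by force
    have "\<exists>t\<in>teich_ring p. X n = witt_poly p (c(n := t)) n"
    proof (cases n)
      case 0
      then show ?thesis
        using Suc.prems by (simp add: witt_poly_def)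
    next
      case (Suc m)
      have "scong (teich_ring p) (of_nat p ^ Suc m) (X (Suc m)) (shift (X m))"
        using Suc.prems \<open>n = Suc m\<close> teich_ring.scong_sym by blast
      also have "scong (teich_ring p) (of_nat p ^ Suc m) (shift (X m)) (\<Sum>i\<le>m. of_nat p ^ i * c i ^ (p ^ (Suc m - i)))"
        using shift_witt_poly_scong[OF assms, of m c] c Suc by simp
      finally obtain t where t: "t \<in> teich_ring p"
        "X n - (\<Sum>i\<le>m. of_nat p ^ i * c i ^ (p ^ (Suc m - i))) = of_nat p ^ Suc m * t"
        unfolding scong_def Suc by blast
      have "X n = (\<Sum>i\<le>m. of_nat p ^ i * c i ^ (p ^ (Suc m - i))) + of_nat p ^ Suc m * t"
        unfolding t(2)[symmetric] by simp
      also have "\<dots> = witt_poly p (c(n := t)) n"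
        unfolding Suc witt_poly_Suc by simp
      finally show ?thesis
        using t(1) by blast
    qed
    then obtain t where t: "t \<in> teich_ring p" "X n = witt_poly p (c(n := t)) n" by blast
    have "X k = witt_poly p (c(n := t)) k" if "k < Suc n" for k
    proof (cases "k = n")
      case False
      then have "k < n" using that by simp
      then show ?thesis
        unfolding c(2)[OF \<open>k < n\<close>] by (intro witt_poly_cong) auto
    qed (use t in simp)
    moreover have "(c(n := t)) i \<in> teich_ring p" if "i < Suc n" for i
      using c(1) t(1) that by (cases "i = n") simp_all
    ultimately show ?case
      by blast
  qed simp
qed

text \<open>Lifting to sequences replaces the image of a nonlinear map by congruences that are
  visibly stable under differences and products; evaluation at \<open>0\<close> returns to
  \<open>R\<close>.\<close>

lemma mem_witt_iff:
  assumes "prime p"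
  shows "x \<in> witt p n \<longleftrightarrow> (\<forall>k\<ge>n. x k = 0) \<and>
    (\<exists>X. (\<forall>k<n. X k \<in> teich_ring p \<and> X k 0 = x k) \<and>
      (\<forall>k. Suc k < n \<longrightarrow> scong (teich_ring p) (of_nat p ^ Suc k) (shift (X k)) (X (Suc k))))"
    (is "?L \<longleftrightarrow> ?R")
proof
  assume ?L
  then obtain a where a: "x = ghost p n a"
    by (auto simp: witt_def)
  define C where "C i = (\<lambda>j. a i ^ (p ^ j))" for i
  have C: "C i \<in> teich_ring p" for i
    unfolding C_def by (rule teich_ring.gen)
  have "(\<forall>k<n. witt_poly p C k \<in> teich_ring p) \<and>
    (\<forall>k. Suc k < n \<longrightarrow> scong (teich_ring p) (of_nat p ^ Suc k) (shift (witt_poly p C k)) (witt_poly p C (Suc k)))"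
    using C by (intro dwork[OF assms, of n "witt_poly p C", THEN iffD1] exI[of _ C]) simp
  moreover have "witt_poly p C k 0 = x k" if "k < n" for k
    using that by (simp add: a ghost_eq_witt_poly witt_poly_apply C_def)
  ultimately show ?R
    by (auto simp: a ghost_eq_witt_poly intro!: exI[of _ "witt_poly p C"])
next
  assume R: ?R
  then obtain X where X: "\<And>k. k < n \<Longrightarrow> X k 0 = x k" and "(\<forall>k<n. X k \<in> teich_ring p) \<and>
      (\<forall>k. Suc k < n \<longrightarrow> scong (teich_ring p) (of_nat p ^ Suc k) (shift (X k)) (X (Suc k)))"
    by blast
  then obtain c where c: "\<And>k. k < n \<Longrightarrow> X k = witt_poly p c k"
    using dwork[OF assms, of n X, THEN iffD2] by metis
  have "x k = ghost p n (\<lambda>i. c i 0) k" for k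
    using R X[of k] c[of k] by (auto simp: ghost_eq_witt_poly witt_poly_apply)
  then have "x = ghost p n (\<lambda>i. c i 0)" ..
  then show ?L
    unfolding witt_def by blast
qed

lemma subrng_witt:
  assumes "prime p"
  shows "subrng (witt p n :: (nat \<Rightarrow> 'a::comm_ring_1) set)"
proof
  let ?P = "\<lambda>X. \<forall>k. Suc k < n \<longrightarrow>
    scong (teich_ring p) (of_nat p ^ Suc k) (shift (X k)) (X (Suc k) :: nat \<Rightarrow> 'a)"
  show "0 \<in> (witt p n :: (nat \<Rightarrow> 'a) set)"
    unfolding mem_witt_iff[OF assms]
    by (intro conjI exI[of _ "\<lambda>k. 0"]) (auto simp: teich_ring.zero_mem[unfolded zero_fun_def] shift_def zero_fun_def intro: teich_ring.scong_refl[unfolded zero_fun_def])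
  fix x y :: "nat \<Rightarrow> 'a" assume "x \<in> witt p n" "y \<in> witt p n"
  then obtain X Y
    where X: "\<forall>k\<ge>n. x k = 0" "\<forall>k<n. X k \<in> teich_ring p \<and> X k 0 = x k" "?P X"
      and Y: "\<forall>k\<ge>n. y k = 0" "\<forall>k<n. Y k \<in> teich_ring p \<and> Y k 0 = y k" "?P Y"
    unfolding mem_witt_iff[OF assms] by blast
  have "?P (\<lambda>k. X k - Y k)"
    using X Y by (auto simp: shift_diff simp del: power_Suc intro!: teich_ring.scong_diff)
  then show "x - y \<in> witt p n"
    unfolding mem_witt_iff[OF assms] using X Y
    by (intro conjI exI[of _ "\<lambda>k. X k - Y k"]) (auto intro: teich_ring.diff)
  have "?P (\<lambda>k. X k * Y k)"
    using X Y by (auto simp: shift_mult simp del: power_Suc intro!: teich_ring.scong_mult shift_mem_teich_ring)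
  then show "x * y \<in> witt p n"
    unfolding mem_witt_iff[OF assms] using X Y
    by (intro conjI exI[of _ "\<lambda>k. X k * Y k"]) (auto intro: teich_ring.mult)
qed

subsection \<open>Dividing a Teichmueller representative by p\<close>

text \<open>This is the numerator of i_m over the denominator \<open>p ^ m\<close>.\<close>

definition repunit :: "nat \<Rightarrow> nat \<Rightarrow> nat" where
  "repunit p m = (\<Sum>i<m. p ^ i)"

lemma repunit_0 [simp]: "repunit p 0 = 0"
  by (simp add: repunit_def)

lemma repunit_Suc: "repunit p (Suc m) = repunit p m + p ^ m"
  by (simp add: repunit_def)

lemma repunit_add: "repunit p (a + b) = repunit p a + p ^ a * repunit p b"
  by (induction b) (simp_all add: repunit_Suc algebra_simps power_add)

lemma repunit_Suc': "repunit p (Suc m) = Suc (p * repunit p m)"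
  using repunit_add[of p 1 m] by (simp add: repunit_Suc)

lemma le_repunit: "p > 0 \<Longrightarrow> m \<le> repunit p m"
proof (induction m)
  case (Suc m)
  then show ?case using one_le_power[of p m] unfolding repunit_Suc by linarith
qed simp

lemma less_repunit:
  assumes "p \<ge> 2" "m \<ge> 2"
  shows "m < repunit p m"
  using assms(2)
proof (induction m rule: dec_induct)
  case base
  then show ?case using assms(1) by (simp add: numeral_2_eq_2 repunit_Suc)
next
  case (step m)
  then show ?case using one_le_power[of p m] assms(1) unfolding repunit_Suc by linarith
qed

lemma p_i_eq: "p_i p rt m = rt m ^ repunit p m"
proof -
  have "(\<Sum>j\<in>{1..m}. p ^ (m - j)) = repunit p m"
    unfolding repunit_def by (rule sum.reindex_bij_witness[of _ "\<lambda>i. m - i" "\<lambda>j. m - j"]) auto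
  then show ?thesis by (simp add: p_i_def)
qed

text \<open>The integers \<open>u\<^sub>k\<close>: \<open>[x] = p \<cdot> ghost z\<close> forces \<open>p ^ repunit p (k + 1) * z\<^sub>k = u\<^sub>k * x ^ (p ^ k)\<close>.\<close>

fun teich_div_coeff :: "nat \<Rightarrow> nat \<Rightarrow> int" where
  "teich_div_coeff p k = int p ^ (repunit p (Suc k) - Suc k)
    - (\<Sum>i<k. int p ^ (repunit p (k - i) - (k - i)) * teich_div_coeff p i ^ (p ^ (k - i)))"

declare teich_div_coeff.simps [simp del]

text \<open>Modulo \<open>p\<close> only the last summand of the recursion survives, since the
  exponent \<open>repunit p j - j\<close> is \<open>0\<close> for \<open>j = 1\<close> and positive
  for \<open>j \<ge> 2\<close>. Thus each coefficient is minus the p-th power of its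
  predecessor.\<close>

lemma teich_div_coeff_not_dvd:
  assumes "prime p"
  shows "\<not> int p dvd teich_div_coeff p k"
proof (induction k)
  case 0
  have "teich_div_coeff p 0 = 1"
    by (subst teich_div_coeff.simps) (simp add: repunit_Suc)
  then show ?case
    using prime_gt_1_nat[OF assms] by simp
next
  case (Suc k)
  have p2: "p \<ge> 2" using prime_ge_2_nat[OF assms] .
  have dvd: "int p dvd int p ^ (repunit p j - j) * a" if "j \<ge> 2" for j a
    using less_repunit[OF p2 that] by (intro dvd_mult2 dvd_power) auto
  have "teich_div_coeff p (Suc k) + teich_div_coeff p k ^ p =
      int p ^ (repunit p (Suc (Suc k)) - Suc (Suc k)) * 1
    - (\<Sum>i<k. int p ^ (repunit p (Suc k - i) - (Suc k - i)) * teich_div_coeff p i ^ (p ^ (Suc k - i)))"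
    by (subst teich_div_coeff.simps) (simp add: repunit_Suc[of _ 0])
  moreover have "int p dvd \<dots>"
    by (intro dvd_diff dvd_sum dvd) auto
  ultimately have "int p dvd teich_div_coeff p (Suc k) + teich_div_coeff p k ^ p"
    by simp
  moreover have "\<not> int p dvd teich_div_coeff p k ^ p"
    using Suc assms prime_dvd_power[of "int p"] by auto
  ultimately show ?case
    by (metis dvd_add_right_iff)
qed

text \<open>Multiplying by the power of \<open>p\<close> clears all denominators, and every summand
  becomes an integer multiple of \<open>x ^ (p ^ k)\<close>. The identity serves both to analyse a
  given quotient by \<open>p\<close> and to construct one.\<close>

lemma teich_div_coeff_identity:
  fixes x :: "'a::comm_ring_1"
  assumes "p > 0" and z: "\<And>i. i < k \<Longrightarrow> of_nat p ^ repunit p (Suc i) * z i = of_int (teich_div_coeff p i) * x ^ (p ^ i)"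
  shows "of_nat p ^ (repunit p (Suc k) - Suc k) * (x ^ (p ^ k) - (\<Sum>i<k. of_nat p ^ Suc i * z i ^ (p ^ (k - i))))
       = of_int (teich_div_coeff p k) * x ^ (p ^ k)"
proof -
  have *: "of_nat p ^ (repunit p (Suc k) - Suc k) * (of_nat p ^ Suc i * z i ^ (p ^ (k - i))) =
      of_int (int p ^ (repunit p (k - i) - (k - i)) * teich_div_coeff p i ^ (p ^ (k - i))) * x ^ (p ^ k)"
    if i: "i < k" for i
  proof -
    \<comment> \<open>This splitting leaves exactly the power of \<open>p\<close> needed to apply
      \<open>z\<close> inside the exponent \<open>p ^ (k - i)\<close>.\<close>
    have "repunit p (Suc k) = repunit p (k - i) + p ^ (k - i) * repunit p (Suc i)"
      using repunit_add[of p "k - i" "Suc i"] i by simp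
    then have "repunit p (Suc k) - Suc k + Suc i = (repunit p (k - i) - (k - i)) + repunit p (Suc i) * p ^ (k - i)"
      using le_repunit[OF assms(1), of "Suc k"] le_repunit[OF assms(1), of "k - i"] i
        mult.commute[of "p ^ (k - i)" "repunit p (Suc i)"]
      by linarith
    then have "of_nat p ^ (repunit p (Suc k) - Suc k) * (of_nat p ^ Suc i * z i ^ (p ^ (k - i))) =
        of_nat p ^ (repunit p (k - i) - (k - i)) * (of_nat p ^ repunit p (Suc i) * z i) ^ (p ^ (k - i))"
      by (metis (no_types, lifting) mult.assoc power_add power_mult power_mult_distrib)
    also have "\<dots> = of_nat p ^ (repunit p (k - i) - (k - i)) * (of_int (teich_div_coeff p i) ^ (p ^ (k - i)) * x ^ (p ^ k))"
      unfolding z[OF i] power_mult_distrib using i by (simp flip: power_mult power_add)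
    finally show ?thesis by (simp add: mult.assoc)
  qed
  have "of_nat p ^ (repunit p (Suc k) - Suc k) * (x ^ (p ^ k) - (\<Sum>i<k. of_nat p ^ Suc i * z i ^ (p ^ (k - i)))) =
      of_nat p ^ (repunit p (Suc k) - Suc k) * x ^ (p ^ k) -
      (\<Sum>i<k. of_int (int p ^ (repunit p (k - i) - (k - i)) * teich_div_coeff p i ^ (p ^ (k - i))) * x ^ (p ^ k))"
    unfolding right_diff_distrib sum_distrib_left using * by simp
  also have "\<dots> = of_int (teich_div_coeff p k) * x ^ (p ^ k)"
    by (subst (2) teich_div_coeff.simps) (simp add: left_diff_distrib sum_distrib_right)
  finally show ?thesis .
qed

lemma dvd_of_int_mult_cancel:
  fixes x :: "'a::comm_ring_1"
  assumes "coprime u (int q)" "of_nat q dvd of_int u * x"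
  shows "of_nat q dvd x"
proof -
  obtain s t where "s * u + t * int q = 1"
    using bezout_int[of u "int q"] assms(1) by auto
  then have "of_int s * of_int u + of_int t * of_nat q = (1 :: 'a)"
    by (metis of_int_1 of_int_add of_int_mult of_int_of_nat_eq)
  then have "x = of_int s * (of_int u * x) + of_nat q * (of_int t * x)"
    by (metis (no_types, lifting) distrib_right mult.assoc mult.commute mult_1)
  then show ?thesis
    using assms(2) by (metis dvd_add dvd_mult dvd_triv_left)
qed

subsection \<open>The perfectoid case\<close>

locale perfectoid_ring =
  fixes p :: nat and rt :: "nat \<Rightarrow> 'a::comm_ring_1"
  assumes prime: "prime p"
    and torsion_free: "p_torsion_free p TYPE('a)"
    and roots: "compatible_roots p rt"
    and perf: "perfectoid p rt"
begin

lemma p_pos: "p > 0"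
  using prime prime_gt_0_nat by blast

lemma cancel_p_power: "of_nat p ^ k * x = of_nat p ^ k * y \<Longrightarrow> x = y" for x y :: 'a
proof (induction k)
  case (Suc k)
  have "of_nat p * (of_nat p ^ k * x - of_nat p ^ k * y) = 0"
    using Suc.prems by (simp add: algebra_simps)
  then have "of_nat p ^ k * x - of_nat p ^ k * y = 0"
    using torsion_free unfolding p_torsion_free_def by blast
  then show ?case using Suc.IH by simp
qed simp

lemma rt_add_power: "rt (j + e) ^ (p ^ j) = rt e"
proof (induction j)
  case (Suc j)
  have "rt (Suc j + e) ^ (p ^ Suc j) = (rt (Suc (j + e)) ^ p) ^ (p ^ j)"
    by (simp flip: power_mult)
  then show ?case
    using Suc roots unfolding compatible_roots_def by simp
qed simp

lemma rt_power: "rt m ^ (p ^ m) = of_nat p"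
  using rt_add_power[of m 0] roots by (simp add: compatible_roots_def)

lemma rt_power_mult: "rt m ^ (p ^ m * k) = of_nat p ^ k"
  by (simp add: power_mult rt_power)

text \<open>A complementary power of \<open>rt m\<close> turns the factor into \<open>p ^ k\<close>,
  which is cancellable.\<close>

lemma cancel_rt_power: "rt m ^ k * x = rt m ^ k * y \<Longrightarrow> x = y"
proof -
  assume "rt m ^ k * x = rt m ^ k * y"
  then have "rt m ^ (p ^ m * k - k) * (rt m ^ k * x) = rt m ^ (p ^ m * k - k) * (rt m ^ k * y)"
    by simp
  moreover have "rt m ^ (p ^ m * k - k) * rt m ^ k = of_nat p ^ k"
  proof -
    have "p ^ m * k = (p ^ m * k - k) + k"
      using p_pos mult_le_mono1[of 1 "p ^ m" k] by simp
    then show ?thesis by (metis power_add rt_power_mult)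
  qed
  ultimately show "x = y"
    using cancel_p_power by (metis mult.assoc)
qed

text \<open>Multiplying \<open>y\<close> by \<open>rt m ^ (p ^ (m - 1) - 1)\<close> makes its p-th
  power divisible by \<open>p\<close>. The perfectoid condition then yields divisibility by
  \<open>rt 1 = rt m ^ (p ^ (m - 1))\<close>, and the extra factor cancels.\<close>

lemma rt_dvd_if_power_dvd:
  assumes "m > 0" "rt m ^ p dvd y ^ p"
  shows "rt m dvd y"
proof -
  obtain l where m: "m = l + 1" using assms(1) by (metis Suc_eq_plus1 gr0_conv_Suc)
  let ?q = "p ^ l"
  have q: "?q > 0" using p_pos by simp
  have "rt m ^ p * rt m ^ ((?q - 1) * p) dvd y ^ p * (rt m ^ (?q - 1)) ^ p"
    using assms(2) by (simp add: mult_dvd_mono power_mult)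
  moreover have "rt m ^ p * rt m ^ ((?q - 1) * p) = of_nat p"
  proof -
    have "p + (?q - 1) * p = p ^ m"
      using q m by (metis Suc_eq_plus1 Suc_pred' mult.commute mult_Suc power_Suc)
    then show ?thesis by (simp add: rt_power flip: power_add)
  qed
  ultimately have "of_nat p dvd (y * rt m ^ (?q - 1)) ^ p"
    by (simp add: power_mult_distrib)
  then have "rt 1 dvd y * rt m ^ (?q - 1)"
    using perf unfolding perfectoid_def by blast
  moreover have "rt 1 = rt m ^ (?q - 1) * rt m"
    using rt_add_power[of l 1] q unfolding m by (metis Suc_pred' power_Suc2)
  ultimately obtain t where "y * rt m ^ (?q - 1) = rt m ^ (?q - 1) * rt m * t"
    unfolding dvd_def by auto
  then have "y = rt m * t"
    using cancel_rt_power by (metis mult.assoc mult.commute)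
  then show ?thesis by simp
qed

lemma rt_power_dvd_if_power_dvd:
  assumes "m > 0"
  shows "rt m ^ (k * p) dvd y ^ p \<Longrightarrow> rt m ^ k dvd y"
proof (induction k arbitrary: y)
  case (Suc k)
  have e: "rt m ^ (Suc k * p) = rt m ^ p * rt m ^ (k * p)"
    by (simp add: power_add)
  then have "rt m dvd y"
    using Suc.prems by (intro rt_dvd_if_power_dvd assms) (metis dvd_mult_left)
  then obtain t where t: "y = rt m * t" by (auto simp: dvd_def)
  obtain s where "y ^ p = rt m ^ (Suc k * p) * s"
    using Suc.prems by (auto simp: dvd_def)
  then have "rt m ^ p * t ^ p = rt m ^ p * (rt m ^ (k * p) * s)"
    unfolding e t power_mult_distrib by (simp add: mult.assoc)
  then have "t ^ p = rt m ^ (k * p) * s"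
    by (rule cancel_rt_power)
  then have "rt m ^ k dvd t"
    using Suc.IH by simp
  then show ?case unfolding t by (simp add: mult_dvd_mono)
qed simp

lemma rt_power_dvd_if_power_dvd_iterate:
  assumes "m > 0"
  shows "rt m ^ (k * p ^ j) dvd y ^ (p ^ j) \<Longrightarrow> rt m ^ k dvd y"
proof (induction j arbitrary: k y)
  case (Suc j)
  then have "rt m ^ (k * p * p ^ j) dvd (y ^ p) ^ (p ^ j)"
    by (simp add: mult.assoc flip: power_mult)
  then show ?case
    using Suc.IH rt_power_dvd_if_power_dvd[OF assms] by blast
qed simp

lemma frobenius_surj: "\<exists>b. of_nat p dvd (b ^ (p ^ j) - a)" for a :: 'a
proof (induction j arbitrary: a)
  case (Suc j)
  obtain y where y: "of_nat p dvd y ^ p - a"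
    using perf unfolding perfectoid_def by blast
  obtain b where "of_nat p dvd b ^ (p ^ j) - y"
    using Suc.IH by blast
  moreover have "b ^ (p ^ j) - y dvd (b ^ (p ^ j)) ^ p - y ^ p"
    by (metis dvd_triv_left power_diff_sumr2)
  ultimately have "of_nat p dvd ((b ^ (p ^ j)) ^ p - y ^ p) + (y ^ p - a)"
    using y by (metis dvd_add dvd_trans)
  then show ?case
    by (auto intro!: exI[of _ b] simp: mult.commute simp flip: power_mult)
qed (metis diff_self dvd_0_right power_0 power_one_right)

end

section \<open>Teichmueller representatives and Verschiebung in ghost coordinates\<close>

lemma teich_apply: "p > 0 \<Longrightarrow> teich p n a k = (if k < n then a ^ (p ^ k) else 0)"
proof -
  assume "p > 0"
  have "witt_poly p (\<lambda>i. if i = 0 then a else 0) k = (\<Sum>i\<le>k. if i = 0 then a ^ (p ^ k) else 0)"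
    unfolding witt_poly_def using \<open>p > 0\<close> by (intro sum.cong) (auto simp: power_0_left)
  then show ?thesis by (simp add: teich_def ghost_eq_witt_poly)
qed

lemma verV_apply:
  assumes "p > 0" "n > 0"
  shows "verV p n a k = (if k = n - 1 then of_nat p ^ k * a else 0)"
proof -
  have "witt_poly p (\<lambda>i. if i = n - 1 then a else 0) k
      = (\<Sum>i\<le>k. if i = n - 1 then of_nat p ^ i * a ^ (p ^ (k - i)) else 0)"
    unfolding witt_poly_def using \<open>p > 0\<close> by (intro sum.cong) (auto simp: power_0_left)
  also have "\<dots> = (if n - 1 \<le> k then of_nat p ^ (n - 1) * a ^ (p ^ (k - (n - 1))) else 0)"
    by simp
  finally show ?thesis
    using assms(2) by (auto simp: verV_def ghost_eq_witt_poly)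
qed

lemma ghost_mem_witt: "ghost p n c \<in> witt p n"
  by (simp add: witt_def)

lemma witt_zero_ge: "x \<in> witt p n \<Longrightarrow> k \<ge> n \<Longrightarrow> x k = 0"
  by (auto simp: witt_def ghost_def)

lemma witt_poly_leading:
  assumes "p > 0" "\<And>i. i < k \<Longrightarrow> c i = 0"
  shows "witt_poly p c k = of_nat p ^ k * c k"
proof -
  have "witt_poly p c k = (\<Sum>i\<le>k. if i = k then of_nat p ^ k * c k else 0)"
    unfolding witt_poly_def using assms by (intro sum.cong) (auto simp: power_0_left)
  then show ?thesis by simp
qed

lemma witt_poly_shifted:
  assumes "p > 0" "c 0 = 0"
  shows "witt_poly p c (Suc k) = of_nat p * witt_poly p (\<lambda>i. c (Suc i)) k"
proof -
  have "witt_poly p c (Suc k) = (\<Sum>i\<le>k. of_nat p ^ Suc i * c (Suc i) ^ (p ^ (k - i)))"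
    unfolding witt_poly_def sum.atMost_Suc_shift using assms by (simp add: power_0_left)
  then show ?thesis
    by (simp add: witt_poly_def sum_distrib_left mult.assoc)
qed

section \<open>Additivity and multiplicativity of \<open>Phi\<close> modulo \<open>p\<close>\<close>

context perfectoid_ring
begin

interpretation W: subrng "witt p n :: (nat \<Rightarrow> 'a) set" for n
  by (rule subrng_witt[OF prime])

abbreviation wcong :: "nat \<Rightarrow> (nat \<Rightarrow> 'a) \<Rightarrow> (nat \<Rightarrow> 'a) \<Rightarrow> bool" where
  "wcong n \<equiv> scong (witt p n) (of_nat p)"

definition Phi :: "nat \<Rightarrow> 'a \<Rightarrow> nat \<Rightarrow> 'a" where
  "Phi n a = teich p n (a ^ p)"

lemma Phi_apply: "Phi n a k = (if k < n then a ^ (p ^ Suc k) else 0)"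
  by (simp add: Phi_def teich_apply p_pos flip: power_mult)

lemma teich_mem_witt: "teich p n a \<in> witt p n"
  by (simp add: teich_def ghost_mem_witt)

lemma Phi_mem_witt: "Phi n a \<in> witt p n"
  by (simp add: Phi_def teich_mem_witt)

lemma Phi_mult: "Phi n (a * b) = Phi n a * Phi n b"
  by (auto simp: Phi_apply fun_eq_iff power_mult_distrib)

lemma Phi_0: "Phi n 0 = 0"
  using p_pos by (auto simp: Phi_apply fun_eq_iff power_0_left)

lemma Phi_1: "Phi n 1 = w_one p n"
  by (simp add: Phi_def w_one_def)

lemma w_one_mult: "x \<in> witt p n \<Longrightarrow> w_one p n * x = x" for x :: "nat \<Rightarrow> 'a"
  using witt_zero_ge[of x p n] by (auto simp: fun_eq_iff w_one_def teich_apply p_pos)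

text \<open>When the earlier components vanish, the k-th ghost coordinate is just
  \<open>p ^ k * c k\<close>, so torsion-freeness gives the next zero.\<close>

lemma mem_witt_leading:
  fixes x :: "nat \<Rightarrow> 'a"
  assumes "x \<in> witt p n" "m \<le> n" "\<And>k. k < m \<Longrightarrow> x k = 0"
  obtains c where "x = ghost p n c" "\<And>k. k < m \<Longrightarrow> c k = 0"
proof -
  obtain c where c: "x = ghost p n c"
    using assms(1) by (auto simp: witt_def)
  have "c k = 0" if "k < m" for k
    using that
  proof (induction k rule: less_induct)
    case (less k)
    then have "of_nat p ^ k * c k = x k"
      using assms(2) by (simp add: c ghost_eq_witt_poly witt_poly_leading p_pos)
    then have "of_nat p ^ k * c k = of_nat p ^ k * 0"
      using assms(3) less.prems by simp
    then show ?case by (rule cancel_p_power)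
  qed
  with c that show ?thesis by blast
qed

text \<open>The function is V y cut off at length \<open>n\<close>: its Witt components are those of
  \<open>y\<close> moved up by one place, preceded by \<open>0\<close>.\<close>

lemma verschiebung_mem_witt:
  fixes y :: "nat \<Rightarrow> 'a"
  assumes "y \<in> witt p n"
  shows "(\<lambda>k. if 0 < k \<and> k < n then of_nat p * y (k - 1) else 0) \<in> witt p n"
proof -
  obtain c where c: "y = ghost p n c"
    using assms by (auto simp: witt_def)
  let ?d = "\<lambda>i. case i of 0 \<Rightarrow> 0 | Suc j \<Rightarrow> c j"
  have "(\<lambda>k. if 0 < k \<and> k < n then of_nat p * y (k - 1) else 0) = ghost p n ?d"
  proof
    fix k
    show "(if 0 < k \<and> k < n then of_nat p * y (k - 1) else 0) = ghost p n ?d k"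
    proof (cases k)
      case 0
      then show ?thesis by (simp add: ghost_def)
    next
      case (Suc l)
      then show ?thesis
        by (simp add: c ghost_eq_witt_poly witt_poly_shifted[OF p_pos, of ?d])
    qed
  qed
  then show ?thesis by (simp add: ghost_mem_witt)
qed

lemma power_p_scong_0:
  assumes "x \<in> witt p n" "x 0 = 0"
  shows "wcong n (x ^ p) 0"
proof (cases "n = 0")
  case True
  then have "x ^ p = 0"
    using witt_zero_ge[OF assms(1)] p_pos by (auto simp: fun_eq_iff power_fun_apply power_0_left)
  then show ?thesis by (simp add: W.scong_refl)
next
  case False
  obtain c where c: "x = ghost p n c" "c 0 = 0"
    using mem_witt_leading[OF assms(1), of 1] assms(2) False by auto
  define y where "y = ghost p n (\<lambda>i. c (Suc i))"
  have xy: "x k = of_nat p * y (k - 1)" if "0 < k" "k < n" for k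
    using that witt_poly_shifted[of p c "k - 1"] c p_pos by (simp add: y_def ghost_eq_witt_poly)
  define v where "v = (\<lambda>k. if 0 < k \<and> k < n then of_nat p * (y ^ p) (k - 1) else 0)"
  have "v \<in> witt p n"
    unfolding v_def y_def by (intro verschiebung_mem_witt W.power_mem ghost_mem_witt p_pos)
  moreover have "x ^ p = of_nat p * (of_nat p ^ (p - 2) * v)"
  proof
    fix k
    \<comment> \<open>Of the \<open>p\<close> factors \<open>p\<close> in a coordinate of
      \<open>x ^ p\<close>, one is absorbed by \<open>v\<close>, one is pulled out as the modulus,
      and \<open>p - 2\<close> remain.\<close>
    have "p = Suc (Suc (p - 2))"
      using prime_ge_2_nat[OF prime] by simp
    then have "of_nat p ^ p = (of_nat p * (of_nat p ^ (p - 2) * of_nat p) :: 'a)"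
      by (metis power_Suc power_Suc2)
    then show "(x ^ p) k = (of_nat p * (of_nat p ^ (p - 2) * v)) k"
      using xy[of k] assms(2) witt_zero_ge[OF assms(1), of k] p_pos
      by (auto simp: v_def power_fun_apply power_mult_distrib power_0_left mult.assoc)
  qed
  ultimately show ?thesis
    unfolding scong_def using W.of_nat_power_mult_mem by auto
qed

lemma power_sum_scong:
  assumes "x \<in> witt p n" "y \<in> witt p n"
  shows "wcong n ((x + y) ^ p) (x ^ p + y ^ p)"
proof -
  obtain z where "z \<in> witt p n" "(x + y) ^ p = x ^ p + y ^ p + of_nat p * z"
    using prime_power_sum[OF prime W.subrng_axioms assms(2), of x] assms W.mult_mem by blast
  then show ?thesis unfolding scong_def by (intro bexI[of _ z]) auto
qed

lemma teich_power: "teich p n a ^ p = Phi n a"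
  using p_pos by (auto simp: fun_eq_iff teich_apply Phi_apply power_fun_apply power_0_left mult.commute simp flip: power_mult)

text \<open>\<open>[a] + [b]\<close> and \<open>[a + b]\<close> differ by some \<open>V y\<close>, and \<open>(V y) ^ p = p ^ (p - 1) V (y ^ p)\<close> vanishes modulo \<open>p\<close>.\<close>

lemma Phi_add: "wcong n (Phi n (a + b)) (Phi n a + Phi n b)"
proof -
  define y where "y = teich p n a + teich p n b - teich p n (a + b)"
  have y: "y \<in> witt p n" "y 0 = 0"
    unfolding y_def by (auto intro: W.diff_mem W.add_mem teich_mem_witt simp: teich_apply p_pos)
  have sum: "teich p n (a + b) + y = teich p n a + teich p n b"
    by (simp add: y_def)
  have "wcong n ((teich p n (a + b) + y) ^ p) (Phi n (a + b) + y ^ p)"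
    using power_sum_scong[OF teich_mem_witt[of n "a + b"] y(1)] by (simp only: teich_power)
  also have "wcong n \<dots> (Phi n (a + b) + 0)"
    by (intro W.scong_add W.scong_refl power_p_scong_0 y)
  finally have "wcong n ((teich p n a + teich p n b) ^ p) (Phi n (a + b))"
    by (simp add: sum)
  then have "wcong n (Phi n (a + b)) ((teich p n a + teich p n b) ^ p)"
    by (rule W.scong_sym)
  also have "wcong n \<dots> (Phi n a + Phi n b)"
    using power_sum_scong[OF teich_mem_witt[of n a] teich_mem_witt[of n b]] by (simp only: teich_power)
  finally show ?thesis .
qed

text \<open>Lets the integer inverse of a coefficient be brought in as a scalar: the ghost
  coordinates of the left side are high powers of \<open>k\<close>, those of the right side are
  \<open>k\<close> itself.\<close>

lemma Phi_of_nat: "wcong n (Phi n (of_nat k)) (of_nat k * w_one p n)"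
proof (induction k)
  case 0
  then show ?case by (simp add: Phi_0 W.scong_refl)
next
  case (Suc k)
  have "wcong n (Phi n (1 + of_nat k)) (Phi n 1 + Phi n (of_nat k))"
    by (rule Phi_add)
  also have "wcong n \<dots> (w_one p n + of_nat k * w_one p n)"
    unfolding Phi_1 by (rule W.scong_add[OF W.scong_refl Suc])
  finally show ?case unfolding of_nat_Suc distrib_right mult_1_left .
qed

section \<open>The kernel of \<open>Phi\<close>\<close>

lemma coprime_teich_div_coeff: "coprime (teich_div_coeff p k) (int (p ^ j))"
proof -
  have "coprime (int p) (teich_div_coeff p k)"
    using teich_div_coeff_not_dvd[OF prime, of k] prime by (intro prime_imp_coprime) auto
  then show ?thesis by (simp add: coprime_commute)
qed

lemma p_power_mult_repunit: "of_nat p ^ (repunit p (Suc k) - Suc k) * (of_nat p ^ Suc k * x) = of_nat p ^ repunit p (Suc k) * (x :: 'a)"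
  using le_repunit[OF p_pos, of "Suc k"] by (simp del: power_Suc flip: mult.assoc power_add)

text \<open>Separates the new component \<open>z k\<close> from the known ones, matching the bracket
  in \<open>teich_div_coeff_identity\<close>.\<close>

lemma p_mult_witt_poly:
  "of_nat p * witt_poly p z k = (\<Sum>i<k. of_nat p ^ Suc i * z i ^ (p ^ (k - i))) + of_nat p ^ Suc k * z k"
  for z :: "nat \<Rightarrow> 'a"
  by (simp add: witt_poly_def sum_distrib_left distrib_left mult.assoc flip: lessThan_Suc_atMost)

text \<open>The last component of the quotient by \<open>p\<close> shows that
  \<open>p ^ repunit p n\<close> divides a coefficient prime to \<open>p\<close> times
  \<open>a ^ (p ^ n)\<close>. After removing the coefficient, a \<open>p ^ n\<close>-th root of the
  divisibility is taken in terms of \<open>rt n\<close>.\<close>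

lemma p_i_dvd_if_Phi_scong_0:
  assumes "n > 0" "wcong n (Phi n a) 0"
  shows "p_i p rt n dvd a"
proof -
  obtain c where c: "Phi n a = of_nat p * ghost p n c"
    using assms(2) by (auto simp: scong_def witt_def)
  have *: "of_nat p ^ repunit p (Suc k) * c k = of_int (teich_div_coeff p k) * (a ^ p) ^ (p ^ k)" if "k < n" for k
    using that
  proof (induction k rule: less_induct)
    case (less k)
    have "(a ^ p) ^ (p ^ k) = of_nat p * witt_poly p c k"
      using fun_cong[OF c, of k] less.prems by (simp add: Phi_apply ghost_eq_witt_poly flip: power_mult)
    then have "(a ^ p) ^ (p ^ k) - (\<Sum>i<k. of_nat p ^ Suc i * c i ^ (p ^ (k - i))) = of_nat p ^ Suc k * c k"
      unfolding p_mult_witt_poly by simp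
    moreover have "of_nat p ^ repunit p (Suc i) * c i = of_int (teich_div_coeff p i) * (a ^ p) ^ (p ^ i)" if "i < k" for i
      using less that by simp
    ultimately show ?case
      using teich_div_coeff_identity[OF p_pos, of k c "a ^ p"] p_power_mult_repunit by metis
  qed
  have "of_nat (p ^ repunit p n) dvd of_int (teich_div_coeff p (n - 1)) * a ^ (p ^ n)"
    using *[of "n - 1"] assms(1) by (cases n) (simp_all add: dvd_def flip: power_mult, metis)
  then have "of_nat p ^ repunit p n dvd a ^ (p ^ n)"
    using dvd_of_int_mult_cancel[OF coprime_teich_div_coeff] by (metis of_nat_power)
  then have "rt n ^ (repunit p n * p ^ n) dvd a ^ (p ^ n)"
    unfolding mult.commute[of "repunit p n"] rt_power_mult .
  then show ?thesis
    unfolding p_i_eq using rt_power_dvd_if_power_dvd_iterate[OF assms(1)] by blast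
qed

lemma p_i_dvd_diff_if_Phi_scong:
  assumes "n > 0" "wcong n (Phi n a) (Phi n b)"
  shows "p_i p rt n dvd a - b"
proof -
  have "wcong n (Phi n (a - b) + Phi n b) (Phi n a)"
    using W.scong_sym[OF Phi_add[of n "a - b" b]] by simp
  also note assms(2)
  finally have "wcong n (Phi n (a - b)) 0"
    by (simp add: scong_def)
  then show ?thesis
    using p_i_dvd_if_Phi_scong_0 assms(1) by blast
qed

section \<open>Leading terms and surjectivity of \<open>Phi\<close>\<close>

text \<open>Division of the Teichmueller vector by \<open>p\<close> succeeds up to index
  \<open>m - 1\<close>; subtracting \<open>p\<close> times this partial quotient leaves the first
  obstruction at index \<open>m\<close>.\<close>

lemma Phi_p_i_leading:
  assumes "m < n"
  shows "\<exists>y\<in>witt p n. wcong n (Phi n (p_i p rt m)) y \<and> (\<forall>k<m. y k = 0) \<and>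
           y m = of_int (teich_div_coeff p m) * of_nat p ^ m"
proof -
  define x where "x = p_i p rt m ^ p"
  have x: "x ^ (p ^ k) = rt m ^ (repunit p m * p ^ Suc k)" for k
    by (simp add: x_def p_i_eq mult.assoc flip: power_mult)
  \<comment> \<open>For \<open>k < m\<close> the power of \<open>p\<close> in
    \<open>x ^ (p ^ k)\<close> is large enough for the k-th component of the quotient to
    exist.\<close>
  have "\<exists>g. x ^ (p ^ k) = of_nat p ^ repunit p (Suc k) * g" if "k < m" for k
  proof -
    have "repunit p m = repunit p (m - Suc k) + p ^ (m - Suc k) * repunit p (Suc k)"
      using repunit_add[of p "m - Suc k" "Suc k"] that by simp
    then have "repunit p m * p ^ Suc k
        = repunit p (m - Suc k) * p ^ Suc k + p ^ (m - Suc k) * p ^ Suc k * repunit p (Suc k)"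
      by (simp add: distrib_right)
    also have "p ^ (m - Suc k) * p ^ Suc k = p ^ m"
      using that by (simp del: power_Suc flip: power_add)
    finally have "x ^ (p ^ k) = of_nat p ^ repunit p (Suc k) * rt m ^ (repunit p (m - Suc k) * p ^ Suc k)"
      unfolding x by (simp only: power_add rt_power_mult mult.commute)
    then show ?thesis by blast
  qed
  then obtain g where g: "\<And>k. k < m \<Longrightarrow> x ^ (p ^ k) = of_nat p ^ repunit p (Suc k) * g k"
    by metis
  \<comment> \<open>The value \<open>0\<close> from \<open>m\<close> on keeps \<open>z m\<close> out
    of coordinate \<open>m\<close>, where the obstruction is read off.\<close>
  define z where "z i = (if i < m then of_int (teich_div_coeff p i) * g i else 0)" for i
  have z: "of_nat p ^ repunit p (Suc i) * z i = of_int (teich_div_coeff p i) * x ^ (p ^ i)" if "i < m" for i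
    using that g by (simp add: z_def)
  define y where "y = Phi n (p_i p rt m) - of_nat p * ghost p n z"
  have y_apply: "y k = x ^ (p ^ k) - of_nat p * witt_poly p z k" if "k < n" for k
    using that by (simp add: y_def x_def Phi_apply ghost_eq_witt_poly flip: power_mult)
  have ident: "of_nat p ^ (repunit p (Suc k) - Suc k) *
      (x ^ (p ^ k) - (\<Sum>i<k. of_nat p ^ Suc i * z i ^ (p ^ (k - i)))) = of_int (teich_div_coeff p k) * x ^ (p ^ k)"
    if "k \<le> m" for k
    using that z by (intro teich_div_coeff_identity p_pos) auto
  have "y k = 0" if "k < m" for k
  proof -
    have "of_nat p ^ (repunit p (Suc k) - Suc k) *
        (x ^ (p ^ k) - (\<Sum>i<k. of_nat p ^ Suc i * z i ^ (p ^ (k - i)))) =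
        of_nat p ^ (repunit p (Suc k) - Suc k) * (of_nat p ^ Suc k * z k)"
      unfolding p_power_mult_repunit using ident[of k] z that by simp
    then have "x ^ (p ^ k) - (\<Sum>i<k. of_nat p ^ Suc i * z i ^ (p ^ (k - i))) = of_nat p ^ Suc k * z k"
      by (rule cancel_p_power)
    then show ?thesis
      using that assms by (simp add: y_apply p_mult_witt_poly algebra_simps)
  qed
  moreover have "y m = of_int (teich_div_coeff p m) * of_nat p ^ m"
  proof -
    have ym: "y m = x ^ (p ^ m) - (\<Sum>i<m. of_nat p ^ Suc i * z i ^ (p ^ (m - i)))"
      using assms by (simp add: y_apply p_mult_witt_poly z_def)
    \<comment> \<open>At \<open>k = m\<close> the element \<open>x ^ (p ^ m)\<close> is a pure power
      of \<open>p\<close>, with exponent \<open>repunit p (Suc m) - 1\<close>, one short of what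
      division would require.\<close>
    have "repunit p m * p ^ Suc m = p ^ m * ((repunit p (Suc m) - Suc m) + m)"
      using le_repunit[OF p_pos, of "Suc m"] unfolding repunit_Suc' by simp
    then have "x ^ (p ^ m) = of_nat p ^ (repunit p (Suc m) - Suc m) * of_nat p ^ m"
      unfolding x by (simp only: rt_power_mult power_add)
    then have "of_nat p ^ (repunit p (Suc m) - Suc m) * y m =
        of_nat p ^ (repunit p (Suc m) - Suc m) * (of_int (teich_div_coeff p m) * of_nat p ^ m)"
      unfolding ym ident[OF order_refl] by (simp add: ac_simps)
    then show ?thesis by (rule cancel_p_power)
  qed
  moreover have "y \<in> witt p n"
    unfolding y_def by (intro W.diff_mem Phi_mem_witt W.of_nat_mult_mem ghost_mem_witt)
  moreover have "wcong n (Phi n (p_i p rt m)) y"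
    unfolding scong_def y_def by (intro bexI[of _ "ghost p n z"] ghost_mem_witt) simp
  ultimately show ?thesis by blast
qed

text \<open>\<open>N\<close> inverts the coefficient at index \<open>m\<close> modulo
  \<open>p\<close>, and the factor \<open>Phi n b\<close> scales coordinate \<open>m\<close> by
  \<open>b ^ (p ^ Suc m)\<close>. \<open>N\<close> does not depend on \<open>b\<close>, so it can
  serve as the unit \<open>w\<close>.\<close>

lemma Phi_leading:
  assumes "m < n"
  shows "\<exists>N. (\<exists>w'. of_nat p dvd (of_nat N * w' - 1 :: 'a)) \<and>
    (\<forall>b. \<exists>y\<in>witt p n. wcong n (Phi n (of_nat N * p_i p rt m * b)) y \<and> (\<forall>k<m. y k = 0) \<and>
           of_nat p ^ Suc m dvd y m - of_nat p ^ m * b ^ (p ^ Suc m))"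
proof -
  obtain y where y: "y \<in> witt p n" "wcong n (Phi n (p_i p rt m)) y" "\<And>k. k < m \<Longrightarrow> y k = 0"
    "y m = of_int (teich_div_coeff p m) * of_nat p ^ m"
    using Phi_p_i_leading[OF assms] by blast
  have "coprime (teich_div_coeff p m) (int p)"
    using coprime_teich_div_coeff[of m 1] by simp
  then obtain s t where st: "s * teich_div_coeff p m + t * int p = 1"
    using bezout_int[of "teich_div_coeff p m" "int p"] by auto
  \<comment> \<open>The Bezout coefficient is reduced to a natural number so that
    \<open>Phi_of_nat\<close> applies.\<close>
  define N where "N = nat (s mod int p)"
  have "int N = s mod int p"
    using p_pos by (simp add: N_def)
  then have "(int N * teich_div_coeff p m) mod int p = (s * teich_div_coeff p m) mod int p"
    by (simp add: mod_mult_left_eq)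
  then have "int p dvd int N * teich_div_coeff p m - s * teich_div_coeff p m"
    by (simp add: mod_eq_dvd_iff)
  then have "int p dvd (int N * teich_div_coeff p m - s * teich_div_coeff p m) - t * int p"
    by simp
  then have "int p dvd int N * teich_div_coeff p m - 1"
    using st by (simp add: algebra_simps)
  then obtain q where "int N * teich_div_coeff p m - 1 = int p * q"
    by (auto simp: dvd_def)
  then have N: "of_nat N * of_int (teich_div_coeff p m) - 1 = (of_nat p * of_int q :: 'a)"
    by (metis of_int_1 of_int_diff of_int_mult of_int_of_nat_eq)
  show ?thesis
  proof (intro exI[of _ N] conjI allI)
    show "\<exists>w'. of_nat p dvd (of_nat N * w' - 1 :: 'a)"
      using N by (intro exI[of _ "of_int (teich_div_coeff p m)"]) simp
    fix b
    define y' where "y' = of_nat N * (Phi n b * y)"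
    have "wcong n (Phi n (of_nat N) * (Phi n b * Phi n (p_i p rt m))) (of_nat N * w_one p n * (Phi n b * y))"
    proof (rule W.scong_mult[OF Phi_of_nat W.scong_mult_left[OF Phi_mem_witt y(2)]])
      show "of_nat N * w_one p n \<in> (witt p n :: (nat \<Rightarrow> 'a) set)"
        unfolding w_one_def by (intro W.of_nat_mult_mem teich_mem_witt)
      show "Phi n b * Phi n (p_i p rt m) \<in> witt p n"
        by (intro W.mult_mem Phi_mem_witt)
    qed
    moreover have "Phi n (of_nat N) * (Phi n b * Phi n (p_i p rt m)) = Phi n (of_nat N * p_i p rt m * b)"
      by (simp only: Phi_mult mult.assoc mult.commute[of "Phi n b"])
    moreover have "of_nat N * w_one p n * (Phi n b * y) = y'"
      using w_one_mult[OF W.mult_mem[OF Phi_mem_witt y(1)]] by (simp add: y'_def mult.assoc)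
    moreover have "y' \<in> witt p n"
      unfolding y'_def by (intro W.of_nat_mult_mem W.mult_mem Phi_mem_witt y)
    moreover have "\<forall>k<m. y' k = 0"
      by (simp add: y'_def y)
    moreover have "y' m - of_nat p ^ m * b ^ (p ^ Suc m) = of_nat p ^ Suc m * (of_int q * b ^ (p ^ Suc m))"
    proof -
      have "y' m - of_nat p ^ m * b ^ (p ^ Suc m)
          = of_nat p ^ m * b ^ (p ^ Suc m) * (of_nat N * of_int (teich_div_coeff p m) - 1)"
        using assms by (simp add: y'_def y(4) Phi_apply algebra_simps)
      then show ?thesis by (simp add: N ac_simps)
    qed
    ultimately show "\<exists>y\<in>witt p n. wcong n (Phi n (of_nat N * p_i p rt m * b)) y \<and> (\<forall>k<m. y k = 0) \<and>
           of_nat p ^ Suc m dvd y m - of_nat p ^ m * b ^ (p ^ Suc m)"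
      by (metis dvd_triv_left)
  qed
qed

text \<open>Descending induction along the Verschiebung filtration.\<close>

lemma Phi_surj_aux:
  assumes "m + j = n" "x \<in> witt p n" "\<And>k. k < m \<Longrightarrow> x k = 0"
  shows "\<exists>a. wcong n x (Phi n a)"
  using assms
proof (induction j arbitrary: m x)
  case 0
  have "x k = 0" for k
    using 0 witt_zero_ge[of x p n k] by (cases "k < n") auto
  then have "x = Phi n 0"
    unfolding Phi_0 by auto
  then show ?case using W.scong_refl by blast
next
  case (Suc j)
  then have mn: "m < n" by simp
  obtain c where c: "x = ghost p n c" "\<And>k. k < m \<Longrightarrow> c k = 0"
    using mem_witt_leading[OF Suc.prems(2), of m] Suc.prems(3) mn by auto
  have xm: "x m = of_nat p ^ m * c m"
    using mn c p_pos by (simp add: ghost_eq_witt_poly witt_poly_leading)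
  \<comment> \<open>Surjectivity of Frobenius modulo \<open>p\<close> matches the leading component
    of \<open>x\<close> by a value of \<open>Phi\<close>.\<close>
  obtain b where "of_nat p dvd b ^ (p ^ Suc m) - c m"
    using frobenius_surj by blast
  then have "of_nat p ^ Suc m dvd of_nat p ^ m * (b ^ (p ^ Suc m) - c m)"
    unfolding power_Suc2 by (intro mult_dvd_mono) auto
  then have b: "of_nat p ^ Suc m dvd of_nat p ^ m * b ^ (p ^ Suc m) - x m"
    by (simp only: xm right_diff_distrib)
  obtain a y where y: "y \<in> witt p n" "wcong n (Phi n a) y" "\<And>k. k < m \<Longrightarrow> y k = 0"
    "of_nat p ^ Suc m dvd y m - of_nat p ^ m * b ^ (p ^ Suc m)"
    using Phi_leading[OF mn] by blast
  have "of_nat p ^ Suc m dvd y m - x m"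
    using dvd_add[OF y(4) b] by simp
  then have "of_nat p ^ Suc m dvd x m - y m"
    by (metis dvd_minus_iff minus_diff_eq)
  then obtain d where d: "x m - y m = of_nat p ^ Suc m * d"
    by (auto simp: dvd_def)
  \<comment> \<open>The mismatch \<open>p ^ Suc m * d\<close> at index \<open>m\<close> is
    \<open>p\<close> times the leading coordinate of this vector, so it is removed without changing
    the class.\<close>
  define v where "v = ghost p n (\<lambda>i. if i = m then d else 0)"
  have v: "v k = (if k = m then of_nat p ^ m * d else 0)" if "k \<le> m" for k
    using that mn witt_poly_leading[OF p_pos, of k "\<lambda>i. if i = m then d else 0"]
    by (auto simp: v_def ghost_eq_witt_poly)
  define x' where "x' = x - y - of_nat p * v"
  have "\<exists>a'. wcong n x' (Phi n a')"
  proof (rule Suc.IH[of "Suc m"])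
    show "x' \<in> witt p n"
      unfolding x'_def v_def by (intro W.diff_mem W.of_nat_mult_mem ghost_mem_witt Suc.prems y)
    show "x' k = 0" if "k < Suc m" for k
      using that d v[of k] y(3)[of k] Suc.prems(3)[of k] by (cases "k = m") (auto simp: x'_def mult.assoc)
  qed (use Suc.prems in simp)
  then obtain a' where a': "wcong n x' (Phi n a')" by blast
  have "wcong n x (x' + y)"
    unfolding scong_def x'_def by (intro bexI[of _ v]) (simp_all add: v_def ghost_mem_witt)
  also have "wcong n \<dots> (Phi n a' + Phi n a)"
    using a' y(2) W.scong_sym by (intro W.scong_add) auto
  also have "wcong n \<dots> (Phi n (a' + a))"
    using Phi_add W.scong_sym by blast
  finally show ?case by blast
qed

lemma Phi_surj: "x \<in> witt p n \<Longrightarrow> \<exists>a. wcong n x (Phi n a)"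
  using Phi_surj_aux[of 0 n n x] by simp

section \<open>The inverse of \<open>Phi\<close> and its value on the last Verschiebung\<close>

text \<open>Both vectors live in coordinate \<open>n - 1\<close> alone, where they differ by a
  multiple of \<open>p ^ n\<close>; that is \<open>p\<close> times the Verschiebung of some
  \<open>d\<close>.\<close>

lemma verV_scong:
  assumes "n > 0" "of_nat p dvd b ^ (p ^ n) - a" "y \<in> witt p n" "\<And>k. k < n - 1 \<Longrightarrow> y k = 0"
    "of_nat p ^ n dvd y (n - 1) - of_nat p ^ (n - 1) * b ^ (p ^ n)"
  shows "wcong n (verV p n a) y"
proof -
  have n: "n = Suc (n - 1)" using assms(1) by simp
  have "of_nat p ^ (n - 1) * of_nat p dvd of_nat p ^ (n - 1) * (b ^ (p ^ n) - a)"
    using assms(2) by (intro mult_dvd_mono) auto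
  then have "of_nat p ^ n dvd of_nat p ^ (n - 1) * b ^ (p ^ n) - of_nat p ^ (n - 1) * a"
    by (metis n power_Suc2 right_diff_distrib)
  from dvd_add[OF assms(5) this] have "of_nat p ^ n dvd y (n - 1) - of_nat p ^ (n - 1) * a"
    by simp
  then have "of_nat p ^ n dvd of_nat p ^ (n - 1) * a - y (n - 1)"
    by (metis dvd_minus_iff minus_diff_eq)
  then obtain d where "of_nat p ^ (n - 1) * a - y (n - 1) = of_nat p ^ n * d"
    by (auto simp: dvd_def)
  then have d: "of_nat p ^ (n - 1) * a - y (n - 1) = of_nat p * (of_nat p ^ (n - 1) * d)"
    using n by (metis mult.assoc power_Suc)
  have "verV p n a - y = of_nat p * verV p n d"
  proof
    fix k
    consider "k < n - 1" | "k = n - 1" | "k \<ge> n" by linarith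
    then show "(verV p n a - y) k = (of_nat p * verV p n d) k"
      using assms(1,4) d witt_zero_ge[OF assms(3)] by cases (auto simp: verV_apply p_pos)
  qed
  then show ?thesis
    unfolding scong_def by (intro bexI[of _ "verV p n d"]) (auto simp: verV_def ghost_mem_witt)
qed

lemma Qlinear_map_exists:
  assumes "n > 0"
  shows "\<exists>psi w. induces_Qlinear p n (p_i p rt n) psi \<and>
           (\<exists>w'. of_nat p dvd (w * w' - 1)) \<and>
           p_i p rt n dvd (psi (w_one p n) - 1) \<and>
           (\<forall>a b. of_nat p dvd (b ^ (p ^ n) - a) \<longrightarrow>
              p_i p rt n dvd (psi (verV p n a) - w * p_i p rt (n - 1) * b))"
proof -
  \<comment> \<open>A choice of preimage; by the kernel computation it is unique modulo
    \<open>p_i p rt n\<close>.\<close>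
  define psi where "psi x = (SOME a. wcong n x (Phi n a))" for x
  have psi: "wcong n x (Phi n (psi x))" if "x \<in> witt p n" for x
    unfolding psi_def by (rule someI_ex) (rule Phi_surj[OF that])
  \<comment> \<open>Reduces every remaining claim to exhibiting a preimage under
    \<open>Phi\<close>.\<close>
  have psi_dvd: "p_i p rt n dvd psi x - a" if "x \<in> witt p n" "wcong n x (Phi n a)" for x a
    using that psi W.scong_sym W.scong_trans by (intro p_i_dvd_diff_if_Phi_scong assms) blast
  have lin1: "p_i p rt n dvd (psi x - psi y)"
    if "x \<in> witt p n" "y \<in> witt p n" "z \<in> witt p n" "(\<lambda>k. x k - y k) = w_p_times p z" for x y z
  proof (rule psi_dvd[OF that(1)])
    have "x - y = of_nat p * z"
      using that(4) by (auto simp: fun_eq_iff w_p_times_def)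
    then have "wcong n x y"
      unfolding scong_def using that(3) by blast
    also note psi[OF that(2)]
    finally show "wcong n x (Phi n (psi y))" .
  qed
  have lin2: "p_i p rt n dvd (psi (w_add x y) - psi x - psi y)" if "x \<in> witt p n" "y \<in> witt p n" for x y
  proof -
    have add: "w_add x y = x + y" by (simp add: w_add_def plus_fun_def)
    have "wcong n (x + y) (Phi n (psi x) + Phi n (psi y))"
      by (intro W.scong_add psi that)
    also have "wcong n \<dots> (Phi n (psi x + psi y))"
      using Phi_add W.scong_sym by blast
    finally have "p_i p rt n dvd psi (x + y) - (psi x + psi y)"
      by (intro psi_dvd W.add_mem that)
    then show ?thesis by (simp add: add diff_diff_eq)
  qed
  have lin3: "p_i p rt n dvd (psi (w_mult (teich p n (a ^ p)) x) - a * psi x)" if "x \<in> witt p n" for a x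
  proof -
    have mult: "w_mult (teich p n (a ^ p)) x = Phi n a * x"
      by (simp add: w_mult_def times_fun_def Phi_def)
    have "wcong n (Phi n a * x) (Phi n (a * psi x))"
      unfolding Phi_mult by (intro W.scong_mult_left Phi_mem_witt psi that)
    then show ?thesis
      unfolding mult by (intro psi_dvd W.mult_mem Phi_mem_witt that)
  qed
  have "induces_Qlinear p n (p_i p rt n) psi"
    unfolding induces_Qlinear_def using lin1 lin2 lin3 by blast
  moreover have "p_i p rt n dvd (psi (w_one p n) - 1)"
    by (intro psi_dvd) (simp_all add: Phi_1 W.scong_refl, simp add: w_one_def teich_mem_witt)
  moreover obtain N w' where N: "of_nat p dvd (of_nat N * w' - 1 :: 'a)"
    "\<forall>b. \<exists>y\<in>witt p n. wcong n (Phi n (of_nat N * p_i p rt (n - 1) * b)) y \<and> (\<forall>k<n - 1. y k = 0) \<and>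
           of_nat p ^ Suc (n - 1) dvd y (n - 1) - of_nat p ^ (n - 1) * b ^ (p ^ Suc (n - 1))"
    using Phi_leading[of "n - 1" n] assms by auto
  \<comment> \<open>Here \<open>b\<close> is any representative of F^{-n}(a), and
    \<open>of_nat N\<close> is the unit \<open>w\<close>.\<close>
  moreover have "p_i p rt n dvd (psi (verV p n a) - of_nat N * p_i p rt (n - 1) * b)"
    if "of_nat p dvd (b ^ (p ^ n) - a)" for a b
  proof (rule psi_dvd)
    obtain y where y: "y \<in> witt p n" "wcong n (Phi n (of_nat N * p_i p rt (n - 1) * b)) y"
      "\<And>k. k < n - 1 \<Longrightarrow> y k = 0" "of_nat p ^ n dvd y (n - 1) - of_nat p ^ (n - 1) * b ^ (p ^ n)"
      using N(2) assms by (metis Suc_pred')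
    have "wcong n (verV p n a) y"
      by (rule verV_scong[OF assms that y(1,3,4)])
    also have "wcong n y (Phi n (of_nat N * p_i p rt (n - 1) * b))"
      by (rule W.scong_sym[OF y(2)])
    finally show "wcong n (verV p n a) (Phi n (of_nat N * p_i p rt (n - 1) * b))" .
  qed (simp add: verV_def ghost_mem_witt)
  ultimately show ?thesis by blast
qed

end

theorem theorem4p7:
  fixes p n :: nat and rt :: "nat \<Rightarrow> 'a::comm_ring_1"
  assumes "prime p"
    and "p_torsion_free p TYPE('a)"
    and "compatible_roots p rt"
    and "perfectoid p rt"
    and "n \<ge> 1"
  shows "\<exists>(psi :: (nat \<Rightarrow> 'a) \<Rightarrow> 'a) (w :: 'a).
           induces_Qlinear p n (p_i p rt n) psi \<and>
           (\<exists>w'. of_nat p dvd (w * w' - 1)) \<and>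
           p_i p rt n dvd (psi (w_one p n) - 1) \<and>
           (\<forall>a b. of_nat p dvd (b ^ (p ^ n) - a) \<longrightarrow>
              p_i p rt n dvd (psi (verV p n a) - w * p_i p rt (n - 1) * b))"
proof -
  interpret perfectoid_ring p rt
    using assms by unfold_locales
  show ?thesis
    using Qlinear_map_exists assms(5) by simp
qed

end
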